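(* Let $\mathcal O_{\mathfrak p}$ be a $K$-orbit of non-zero nilpotent elements in $\mathfrak p$ and let $\zeta\in\mathcal O_{\mathfrak p}$. For $t\in\mathbb R$ put $f_t(\zeta)=\mathrm{Ad}(\exp(t\,\mathrm{Re}\,\zeta))(\zeta)$ and write $$m(t)=m(f_t(\zeta))=m_1(t)+m_2(t)+m_3(t),$$ with $m_1(t)\in\mathbb R\cdot\mathrm{Re}\,\zeta$, $m_2(t)\in\mathfrak p_{\mathbb R}\cap(\mathrm{Re}\,\zeta)^\perp$, $m_3(t)\in i\,\mathfrak k_{\mathbb R}$. Then for every $t\in\mathbb R$, $$\|m_1(t)\|^2+\|m_3(t)\|^2\ \ge\ \|m(0)\|^2 .$$
   Context: $\mathfrak g_{\mathbb R}$ is a real semisimple Lie algebra with Cartan decomposition $\mathfrak g_{\mathbb R}=\mathfrak k_{\mathbb R}\oplus\mathfrak p_{\mathbb R}$ and Cartan involution $\theta$; $\mathfrak g=\mathfrak k\oplus\mathfrak p$ is the complexification, with $\theta$ extended complex linearly; $\bar\zeta$ and $\mathrm{Re}\,\zeta$ are taken with respect to the real form $\mathfrak g_{\mathbb R}$. $G=\mathrm{Aut}(\mathfrak g)^0$ and $K\subset G$ is the connected subgroup with Lie algebra $\mathfrak k$. $B$ is the complex bilinear extension to $\mathfrak g$ of a positive multiple of the Killing form of $\mathfrak g_{\mathbb R}$, and $\|\zeta\|^2=-B(\zeta,\theta\bar\zeta)$ is the norm of the positive definite hermitian inner product $(\zeta_1,\zeta_2)=-B(\zeta_1,\theta\bar\zeta_2)$;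 $\perp$ refers to this inner product. The moment map is $$m:\mathfrak g-\{0\}\to i\,\mathfrak u_{\mathbb R}=i\,\mathfrak k_{\mathbb R}\oplus\mathfrak p_{\mathbb R},\qquad m(\zeta)=-\frac{[\zeta,\theta\bar\zeta]}{\|\zeta\|^2},$$ where $\mathfrak u_{\mathbb R}=\mathfrak k_{\mathbb R}\oplus i\,\mathfrak p_{\mathbb R}$. Since $m$ takes values in $i\mathfrak k_{\mathbb R}\oplus\mathfrak p_{\mathbb R}$, the decomposition $m_1+m_2+m_3$ exists and is unique. *)

theory Defs
  imports "HOL-Analysis.Analysis" "HOL-Algebra.Generated_Groups"
begin

section \<open>Real Lie algebras\<close>

text \<open>
  The underlying finite-dimensional real vector space is a type of class \<open>euclidean_space\<close>. Its
  inner product is auxiliary: it provides the topology and computes traces, neither of which depends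
  on its choice, and it is unrelated to the bracket.
\<close>

definition lie_algebra :: "('a::real_vector \<Rightarrow> 'a \<Rightarrow> 'a) \<Rightarrow> bool" where
  "lie_algebra br \<longleftrightarrow> bilinear br \<and> (\<forall>x. br x x = 0) \<and>
     (\<forall>x y z. br x (br y z) + br y (br z x) + br z (br x y) = 0)"

definition lie_ideal :: "('a::real_vector \<Rightarrow> 'a \<Rightarrow> 'a) \<Rightarrow> 'a set \<Rightarrow> bool" where
  "lie_ideal br I \<longleftrightarrow> subspace I \<and> (\<forall>x. \<forall>y\<in>I. br x y \<in> I)"

definition derived_algebra :: "('a::real_vector \<Rightarrow> 'a \<Rightarrow> 'a) \<Rightarrow> 'a set \<Rightarrow> 'a set" where
  "derived_algebra br S = span {br x y | x y. x \<in> S \<and> y \<in> S}"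

definition lie_solvable :: "('a::real_vector \<Rightarrow> 'a \<Rightarrow> 'a) \<Rightarrow> 'a set \<Rightarrow> bool" where
  "lie_solvable br S \<longleftrightarrow> (\<exists>n. (derived_algebra br ^^ n) S = {0})"

definition semisimple :: "('a::real_vector \<Rightarrow> 'a \<Rightarrow> 'a) \<Rightarrow> bool" where
  "semisimple br \<longleftrightarrow> lie_algebra br \<and> (\<forall>I. lie_ideal br I \<and> lie_solvable br I \<longrightarrow> I = {0})"

definition lin_trace :: "('a::euclidean_space \<Rightarrow> 'a) \<Rightarrow> real" where
  "lin_trace f = (\<Sum>b\<in>Basis. f b \<bullet> b)"

definition killing_form :: "('a::euclidean_space \<Rightarrow> 'a \<Rightarrow> 'a) \<Rightarrow> 'a \<Rightarrow> 'a \<Rightarrow> real" where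
  "killing_form br x y = lin_trace (br x \<circ> br y)"

definition cartan_involution ::
    "('a::euclidean_space \<Rightarrow> 'a \<Rightarrow> 'a) \<Rightarrow> ('a \<Rightarrow> 'a) \<Rightarrow> bool" where
  "cartan_involution br \<theta> \<longleftrightarrow> linear \<theta> \<and> (\<forall>x. \<theta> (\<theta> x) = x) \<and>
     (\<forall>x y. \<theta> (br x y) = br (\<theta> x) (\<theta> y)) \<and>
     (\<forall>x. x \<noteq> 0 \<longrightarrow> - killing_form br x (\<theta> x) > 0)"

definition kR :: "('a::real_vector \<Rightarrow> 'a) \<Rightarrow> 'a set" where
  "kR \<theta> = {x. \<theta> x = x}"

definition pR :: "('a::real_vector \<Rightarrow> 'a) \<Rightarrow> 'a set" where
  "pR \<theta> = {x. \<theta> x = - x}"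


section \<open>The complexification\<close>

text \<open>The pair \<open>(x, y)\<close> stands for \<open>x + i y\<close>; addition and real scaling are those of the product type.\<close>

type_synonym 'a cplxn = "'a \<times> 'a"

definition of_real_form :: "'a::real_vector \<Rightarrow> 'a cplxn" where
  "of_real_form x = (x, 0)"

definition cscale :: "complex \<Rightarrow> 'a::real_vector cplxn \<Rightarrow> 'a cplxn" where
  "cscale a \<zeta> = (Re a *\<^sub>R fst \<zeta> - Im a *\<^sub>R snd \<zeta>, Re a *\<^sub>R snd \<zeta> + Im a *\<^sub>R fst \<zeta>)"

definition cnjg :: "'a::real_vector cplxn \<Rightarrow> 'a cplxn" where
  "cnjg \<zeta> = (fst \<zeta>, - snd \<zeta>)"

definition re_part :: "'a::real_vector cplxn \<Rightarrow> 'a cplxn" where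
  "re_part \<zeta> = (1/2) *\<^sub>R (\<zeta> + cnjg \<zeta>)"

definition cbr :: "('a::real_vector \<Rightarrow> 'a \<Rightarrow> 'a) \<Rightarrow> 'a cplxn \<Rightarrow> 'a cplxn \<Rightarrow> 'a cplxn" where
  "cbr br \<zeta> \<xi> = (br (fst \<zeta>) (fst \<xi>) - br (snd \<zeta>) (snd \<xi>), br (fst \<zeta>) (snd \<xi>) + br (snd \<zeta>) (fst \<xi>))"

definition cinv :: "('a::real_vector \<Rightarrow> 'a) \<Rightarrow> 'a cplxn \<Rightarrow> 'a cplxn" where
  "cinv \<theta> \<zeta> = (\<theta> (fst \<zeta>), \<theta> (snd \<zeta>))"

definition cform :: "('a::real_vector \<Rightarrow> 'a \<Rightarrow> real) \<Rightarrow> 'a cplxn \<Rightarrow> 'a cplxn \<Rightarrow> complex" where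
  "cform B \<zeta> \<xi> = Complex (B (fst \<zeta>) (fst \<xi>) - B (snd \<zeta>) (snd \<xi>))
                        (B (fst \<zeta>) (snd \<xi>) + B (snd \<zeta>) (fst \<xi>))"

definition kC :: "('a::real_vector \<Rightarrow> 'a) \<Rightarrow> 'a cplxn set" where
  "kC \<theta> = kR \<theta> \<times> kR \<theta>"

definition pC :: "('a::real_vector \<Rightarrow> 'a) \<Rightarrow> 'a cplxn set" where
  "pC \<theta> = pR \<theta> \<times> pR \<theta>"

definition ad_nilpotent :: "('a::real_vector \<Rightarrow> 'a \<Rightarrow> 'a) \<Rightarrow> 'a cplxn \<Rightarrow> bool" where
  "ad_nilpotent br \<zeta> \<longleftrightarrow> (\<exists>n. \<forall>\<xi>. (cbr br \<zeta> ^^ n) \<xi> = 0)"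


section \<open>The groups\<close>

definition lie_aut :: "('a::real_vector \<Rightarrow> 'a \<Rightarrow> 'a) \<Rightarrow> ('a cplxn \<Rightarrow> 'a cplxn) set" where
  "lie_aut br = {g. bij g \<and> (\<forall>\<zeta> \<xi>. g (\<zeta> + \<xi>) = g \<zeta> + g \<xi>) \<and> (\<forall>a \<zeta>. g (cscale a \<zeta>) = cscale a (g \<zeta>)) \<and>
     (\<forall>\<zeta> \<xi>. g (cbr br \<zeta> \<xi>) = cbr br (g \<zeta>) (g \<xi>))}"

text \<open>
  The identity component is taken in the topology of pointwise convergence, which on linear maps
  between finite-dimensional spaces is the usual topology.
\<close>

definition Ggrp :: "('a::euclidean_space \<Rightarrow> 'a \<Rightarrow> 'a) \<Rightarrow> ('a cplxn \<Rightarrow> 'a cplxn) monoid" where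
  "Ggrp br = \<lparr>carrier = connected_component_set (lie_aut br) id, mult = (\<circ>), one = id\<rparr>"

text \<open>
  The Lie algebra of \<open>Ggrp br\<close> consists of the derivations \<open>ad X\<close>, and is identified with the
  complexified Lie algebra. Under this identification the exponential map sends \<open>X\<close> to the operator
  exponential of \<open>ad X\<close>, and the adjoint action \<open>Ad g\<close> of a group element is \<open>g\<close> itself,
  because \<open>g \<circ> ad X \<circ> inv g = ad (g X)\<close>.
\<close>

definition lie_exp :: "('a::euclidean_space \<Rightarrow> 'a \<Rightarrow> 'a) \<Rightarrow> 'a cplxn \<Rightarrow> 'a cplxn \<Rightarrow> 'a cplxn" where
  "lie_exp br X = (\<lambda>\<xi>. \<Sum>n. (cbr br X ^^ n) \<xi> /\<^sub>R fact n)"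

definition Ad :: "('a::euclidean_space cplxn \<Rightarrow> 'a cplxn) \<Rightarrow> 'a cplxn \<Rightarrow> 'a cplxn" where
  "Ad g \<zeta> = g \<zeta>"

text \<open>The connected subgroup with a given Lie algebra is the subgroup generated by its exponentials.\<close>

definition Kgrp ::
    "('a::euclidean_space \<Rightarrow> 'a \<Rightarrow> 'a) \<Rightarrow> ('a \<Rightarrow> 'a) \<Rightarrow> ('a cplxn \<Rightarrow> 'a cplxn) set" where
  "Kgrp br \<theta> = generate (Ggrp br) (lie_exp br ` kC \<theta>)"

definition K_orbit ::
    "('a::euclidean_space \<Rightarrow> 'a \<Rightarrow> 'a) \<Rightarrow> ('a \<Rightarrow> 'a) \<Rightarrow> 'a cplxn \<Rightarrow> 'a cplxn set" where
  "K_orbit br \<theta> \<zeta> = (\<lambda>g. Ad g \<zeta>) ` Kgrp br \<theta>"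


section \<open>The hermitian inner product and the moment map\<close>

definition herm ::
    "('a::real_vector \<Rightarrow> 'a \<Rightarrow> real) \<Rightarrow> ('a \<Rightarrow> 'a) \<Rightarrow> 'a cplxn \<Rightarrow> 'a cplxn \<Rightarrow> complex" where
  "herm B \<theta> \<zeta> \<xi> = - cform B \<zeta> (cinv \<theta> (cnjg \<xi>))"

text \<open>The value \<open>herm B \<theta> \<zeta> \<zeta>\<close> is real, so taking \<open>Re\<close> only changes its type.\<close>

definition hnorm :: "('a::real_vector \<Rightarrow> 'a \<Rightarrow> real) \<Rightarrow> ('a \<Rightarrow> 'a) \<Rightarrow> 'a cplxn \<Rightarrow> real" where
  "hnorm B \<theta> \<zeta> = sqrt (Re (herm B \<theta> \<zeta> \<zeta>))"

definition moment_map ::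
    "('a::real_vector \<Rightarrow> 'a \<Rightarrow> 'a) \<Rightarrow> ('a \<Rightarrow> 'a \<Rightarrow> real) \<Rightarrow> ('a \<Rightarrow> 'a) \<Rightarrow> 'a cplxn \<Rightarrow> 'a cplxn" where
  "moment_map br B \<theta> \<zeta> = - (cbr br \<zeta> (cinv \<theta> (cnjg \<zeta>)) /\<^sub>R (hnorm B \<theta> \<zeta>)\<^sup>2)"

lemma moment_map_codomain:
  assumes br: "lie_algebra br" and \<theta>: "cartan_involution br \<theta>"
  shows "\<exists>p\<in>pR \<theta>. \<exists>k\<in>kR \<theta>. moment_map br B \<theta> \<zeta> = of_real_form p + cscale \<i> (of_real_form k)"
proof -
  obtain x y where \<zeta>: "\<zeta> = (x, y)" by (cases \<zeta>)
  define c where "c = inverse ((hnorm B \<theta> \<zeta>)\<^sup>2)"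
  have lin: "linear \<theta>" and inv: "\<And>x. \<theta> (\<theta> x) = x" and hom: "\<And>x y. \<theta> (br x y) = br (\<theta> x) (\<theta> y)"
    using \<theta> by (auto simp: cartan_involution_def)
  have bil: "bilinear br" and alt: "\<And>x. br x x = 0"
    using br by (auto simp: lie_algebra_def)
  have skew: "br u v = - br v u" for u v
    using alt[of "u + v"] alt[of u] alt[of v]
    by (simp add: bilinear_ladd[OF bil] bilinear_radd[OF bil] add_eq_0_iff)
  define p where "p = - (c *\<^sub>R (br x (\<theta> x) + br y (\<theta> y)))"
  define k where "k = - (c *\<^sub>R (br y (\<theta> x) - br x (\<theta> y)))"
  have "\<theta> p = - p"
    unfolding p_def
    by (simp add: linear_neg[OF lin] linear_scale[OF lin] linear_add[OF lin] linear_diff[OF lin] hom inv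
        skew[of "\<theta> x" x] skew[of "\<theta> y" y] algebra_simps)
  moreover have "\<theta> k = k"
    unfolding k_def
    by (simp add: linear_neg[OF lin] linear_scale[OF lin] linear_add[OF lin] linear_diff[OF lin] hom inv
        skew[of "\<theta> x" y] skew[of "\<theta> y" x] algebra_simps)
  moreover have "moment_map br B \<theta> \<zeta> = of_real_form p + cscale \<i> (of_real_form k)"
    by (simp add: moment_map_def flip: c_def)
      (simp add: p_def k_def \<zeta> cbr_def cinv_def cnjg_def of_real_form_def cscale_def
        linear_neg[OF lin] bilinear_rneg[OF bil] algebra_simps)
  ultimately show ?thesis by (auto simp: pR_def kR_def)
qed

definition flow :: "('a::euclidean_space \<Rightarrow> 'a \<Rightarrow> 'a) \<Rightarrow> real \<Rightarrow> 'a cplxn \<Rightarrow> 'a cplxn" where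
  "flow br t \<zeta> = Ad (lie_exp br (t *\<^sub>R re_part \<zeta>)) \<zeta>"

end

theory Submission imports Defs begin

text \<open>
  Write \<open>\<zeta> = x + i y\<close> with \<open>x\<close>, \<open>y\<close> in \<open>pR \<theta>\<close>, and let
  \<open>A = ad x\<close>, which is self-adjoint for the inner product \<open>(u, v) = - B u (\<theta> v)\<close>. Nilpotency gives
  \<open>B(\<zeta>, \<zeta>) = 0\<close>, hence \<open>|x|^2 = |y|^2 = r\<close> with \<open>r > 0\<close>. The flow sends \<open>\<zeta>\<close> to
  \<open>x + i Y\<close> with \<open>Y = exp (t A) y\<close>. With \<open>F = |Y|^2\<close> and \<open>S = |A y|^2\<close> one finds
  \<open>|m1|^2 = F'^2 / (4 r (r + F)^2)\<close>, \<open>|m3|^2 = (F'' / 2 + 2 S) / (r + F)^2\<close> and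
  \<open>|m(0)|^2 = S / r^2\<close>. Since \<open>F\<close> is a power series in \<open>t^2\<close> whose coefficients are moments of
  \<open>A\<close>, Cauchy-Schwarz yields \<open>r F'' \<ge> 4 S F\<close>; multiplying by \<open>F'\<close> and integrating,
  \<open>r F'^2 \<ge> 4 S (F^2 - r^2)\<close>. Adding these two estimates gives the claim.
\<close>

section \<open>Traces and the Killing form\<close>

text \<open>In matrix entries over \<open>Basis\<close>, both sides are the same double sum in
  opposite orders.\<close>

lemma lin_trace_comp_commute:
  assumes f: "linear f" and g: "linear (g :: 'a::euclidean_space \<Rightarrow> 'a)"
  shows "lin_trace (f \<circ> g) = lin_trace (g \<circ> f)"
proof -
  have expand: "h (k b) \<bullet> b = (\<Sum>c\<in>Basis. (k b \<bullet> c) * (h c \<bullet> b))"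
    if "linear h" for h k :: "'a \<Rightarrow> 'a" and b
  proof -
    have "h (k b) = h (\<Sum>c\<in>Basis. (k b \<bullet> c) *\<^sub>R c)" by (simp add: euclidean_representation)
    also have "\<dots> = (\<Sum>c\<in>Basis. (k b \<bullet> c) *\<^sub>R h c)"
      by (simp add: linear_sum[OF that] linear_scale[OF that])
    finally show ?thesis by (simp add: inner_sum_left)
  qed
  have "lin_trace (f \<circ> g) = (\<Sum>b\<in>Basis. \<Sum>c\<in>Basis. (g b \<bullet> c) * (f c \<bullet> b))"
    by (simp add: lin_trace_def expand[OF f])
  also have "\<dots> = (\<Sum>c\<in>Basis. \<Sum>b\<in>Basis. (f c \<bullet> b) * (g b \<bullet> c))"
    by (subst sum.swap) (simp add: mult.commute)
  also have "\<dots> = lin_trace (g \<circ> f)"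
    by (simp add: lin_trace_def expand[OF g])
  finally show ?thesis .
qed

lemma linear_funpow: "linear f \<Longrightarrow> linear (f ^^ n)" for f :: "'a::real_vector \<Rightarrow> 'a"
  by (induction n) (auto simp: linear_id linear_compose id_def[symmetric])

lemma subspace_projection:
  fixes V :: "'a::euclidean_space set"
  assumes "subspace V"
  obtains P where "linear P" "range P \<subseteq> V" "\<And>v. v \<in> V \<Longrightarrow> P v = v"
  using linear_exists_left_inverse_on[OF linear_id assms] by (auto simp: image_def)

text \<open>
  With \<open>P k\<close> a projection onto the range of \<open>T ^^ k\<close>, cyclicity of the trace gives
  \<open>tr (T \<circ> P k) = tr (P (k+1) \<circ> T \<circ> P k) = tr (T \<circ> P (k+1))\<close>.
\<close>
lemma lin_trace_nilpotent:
  fixes T :: "'a::euclidean_space \<Rightarrow> 'a"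
  assumes T: "linear T" and nil: "\<And>v. (T ^^ n) v = 0"
  shows "lin_trace T = 0"
proof -
  have "\<exists>P. linear P \<and> range P \<subseteq> range (T ^^ k) \<and> (\<forall>v\<in>range (T ^^ k). P v = v)" for k
  proof -
    have "subspace (range (T ^^ k))"
      using linear_subspace_image[OF linear_funpow[OF T] subspace_UNIV] .
    then show ?thesis by (rule subspace_projection) blast
  qed
  then obtain P where P: "\<And>k. linear (P k)" and ran: "\<And>k v. P k v \<in> range (T ^^ k)"
    and fixed: "\<And>k v. v \<in> range (T ^^ k) \<Longrightarrow> P k v = v"
    by (metis range_subsetD)
  have dec: "range (T ^^ Suc k) \<subseteq> range (T ^^ k)" for k
    by (auto simp: funpow_Suc_right simp del: funpow.simps)
  have step: "lin_trace (T \<circ> P k) = lin_trace (T \<circ> P (Suc k))" for k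
  proof -
    have "T (P k v) \<in> range (T ^^ Suc k)" for v
      using ran[of k v] by auto
    then have "lin_trace (T \<circ> P k) = lin_trace (P (Suc k) \<circ> (T \<circ> P k))"
      by (simp add: lin_trace_def fixed del: funpow.simps)
    also have "\<dots> = lin_trace ((T \<circ> P k) \<circ> P (Suc k))"
      by (rule lin_trace_comp_commute) (auto intro: linear_compose P T)
    also have "\<dots> = lin_trace (T \<circ> P (Suc k))"
      using subsetD[OF dec ran] by (simp add: lin_trace_def fixed del: funpow.simps)
    finally show ?thesis .
  qed
  have "lin_trace T = lin_trace (T \<circ> P 0)"
    by (simp add: lin_trace_def fixed)
  also have "\<dots> = lin_trace (T \<circ> P n)"
    by (induction n) (rule refl, erule trans, rule step)
  also have "\<dots> = 0"
  proof -
    have "P n v = 0" for v using ran[of n v] nil by auto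
    then show ?thesis by (simp add: lin_trace_def linear_0[OF T])
  qed
  finally show ?thesis .
qed

text \<open>Only the two diagonal blocks of an operator on the product contribute to its
  trace.\<close>

lemma lin_trace_fst_snd:
  fixes T :: "'a::euclidean_space \<times> 'a \<Rightarrow> 'a \<times> 'a"
  shows "lin_trace T = lin_trace (\<lambda>u. fst (T (u, 0))) + lin_trace (\<lambda>u. snd (T (0, u)))"
  unfolding lin_trace_def Basis_prod_def
  by (subst sum.union_disjoint) (auto simp: sum.reindex inj_on_def inner_prod_def)

lemma lin_trace_diff: "lin_trace (\<lambda>u. f u - g u) = lin_trace f - lin_trace g"
  by (simp add: lin_trace_def inner_diff_left sum_subtractf)

lemma linear_cbr: "bilinear br \<Longrightarrow> linear (cbr br \<zeta>)"
  by (rule linearI) (auto simp: cbr_def bilinear_radd bilinear_rmul algebra_simps)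

text \<open>The square of \<open>ad (x + i y)\<close> is nilpotent, so its trace vanishes. The real
  part of that complex trace is the difference of the two Killing values.\<close>

lemma killing_form_eq_of_ad_nilpotent:
  fixes br :: "'a::euclidean_space \<Rightarrow> 'a \<Rightarrow> 'a"
  assumes bil: "bilinear br" and nil: "ad_nilpotent br (x, y)"
  shows "killing_form br x x = killing_form br y y"
proof -
  let ?T = "cbr br (x, y) ^^ 2"
  obtain n where n: "\<And>\<xi>. (cbr br (x, y) ^^ n) \<xi> = 0"
    using nil by (auto simp: ad_nilpotent_def)
  \<comment> \<open>The exponent \<open>n\<close> also serves for the square, whose
    \<open>n\<close>-th power is the \<open>n\<close>-th power of the operator applied
    twice.\<close>
  have "(?T ^^ n) v = 0" for v
    using n linear_0[OF linear_funpow[OF linear_cbr[OF bil]]]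
    by (simp add: funpow_mult mult.commute[of 2] mult_2_right funpow_add)
  then have "lin_trace ?T = 0"
    by (intro lin_trace_nilpotent linear_funpow linear_cbr[OF bil])
  \<comment> \<open>Both diagonal blocks of the square equal \<open>(ad x)^2 - (ad y)^2\<close>,
    hence the factor 2.\<close>
  moreover have "lin_trace ?T = 2 * (killing_form br x x - killing_form br y y)"
    by (subst lin_trace_fst_snd)
      (simp add: numeral_2_eq_2 cbr_def lin_trace_diff killing_form_def o_def
        bilinear_rzero[OF bil] bilinear_lzero[OF bil] bilinear_rneg[OF bil])
  ultimately show ?thesis by simp
qed

section \<open>Symmetry and invariance of the Killing form\<close>

lemma lie_algebra_skew:
  assumes "lie_algebra br" shows "br x y = - br y x"
proof -
  have bil: "bilinear br" and alt: "\<And>x. br x x = 0"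
    using assms by (auto simp: lie_algebra_def)
  show ?thesis
    using alt[of "x + y"] alt[of x] alt[of y]
    by (simp add: bilinear_ladd[OF bil] bilinear_radd[OF bil] add_eq_0_iff)
qed

lemma linear_ad: "bilinear br \<Longrightarrow> linear (br x)"
  by (simp add: bilinear_def)

lemma killing_form_commute:
  "bilinear br \<Longrightarrow> killing_form br x y = killing_form br y x"
  unfolding killing_form_def by (intro lin_trace_comp_commute linear_ad)

lemma killing_form_bilinear:
  assumes "bilinear br" shows "bilinear (killing_form br)"
  unfolding bilinear_def
  by (auto intro!: linearI simp: killing_form_def lin_trace_def bilinear_ladd[OF assms]
      bilinear_radd[OF assms] bilinear_lmul[OF assms] bilinear_rmul[OF assms]
      inner_add_left sum.distrib sum_distrib_left)

text \<open>By Jacobi, \<open>ad\<close> takes brackets to commutators. Cyclicity of the trace then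
  moves \<open>ad y\<close> past \<open>ad x \<circ> ad z\<close>.\<close>

lemma killing_form_invariant:
  assumes L: "lie_algebra br"
  shows "killing_form br (br x y) z = killing_form br x (br y z)"
proof -
  have bil: "bilinear br" using L by (simp add: lie_algebra_def)
  note lin = linear_ad[OF bil]
  have ad: "br (br u v) w = br u (br v w) - br v (br u w)" for u v w
  proof -
    have "br u (br v w) + br v (br w u) + br w (br u v) = 0"
      using L by (simp add: lie_algebra_def)
    then show ?thesis
      using lie_algebra_skew[OF L, of w "br u v"] lie_algebra_skew[OF L, of w u]
      by (simp add: bilinear_rneg[OF bil] algebra_simps)
  qed
  have "killing_form br (br x y) z
      = lin_trace (br x \<circ> (br y \<circ> br z)) - lin_trace (br y \<circ> (br x \<circ> br z))"
    by (simp add: killing_form_def o_def ad flip: lin_trace_diff)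
  also have "lin_trace (br y \<circ> (br x \<circ> br z)) = lin_trace ((br x \<circ> br z) \<circ> br y)"
    by (intro lin_trace_comp_commute linear_compose lin)
  also have "lin_trace (br x \<circ> (br y \<circ> br z)) - \<dots> = killing_form br x (br y z)"
    by (simp add: killing_form_def o_def ad linear_diff[OF lin] flip: lin_trace_diff)
  finally show ?thesis .
qed

text \<open>An automorphism conjugates \<open>ad x\<close> into \<open>ad (\<theta> x)\<close>, and
  conjugation preserves traces.\<close>

lemma killing_form_automorphism:
  assumes bil: "bilinear br" and lin: "linear \<theta>" and inv: "\<And>x. \<theta> (\<theta> x) = x"
    and hom: "\<And>x y. \<theta> (br x y) = br (\<theta> x) (\<theta> y)"
  shows "killing_form br (\<theta> x) (\<theta> y) = killing_form br x y"
proof -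
  note linad = linear_ad[OF bil]
  have "killing_form br (\<theta> x) (\<theta> y) = lin_trace ((\<theta> \<circ> (br x \<circ> br y)) \<circ> \<theta>)"
    by (simp add: killing_form_def o_def hom inv)
  also have "\<dots> = lin_trace (\<theta> \<circ> (\<theta> \<circ> (br x \<circ> br y)))"
    by (intro lin_trace_comp_commute linear_compose lin linad)
  also have "\<dots> = killing_form br x y"
    by (simp add: killing_form_def o_def inv)
  finally show ?thesis .
qed


section \<open>The exponential of a self-adjoint operator\<close>

text \<open>The vector \<open>exp (t A) y\<close>, summed in the space itself rather than among
  operators, which matches the form of \<open>lie_exp\<close>.\<close>

definition exp_series :: "('a::euclidean_space \<Rightarrow> 'a) \<Rightarrow> real \<Rightarrow> 'a \<Rightarrow> 'a" where
  "exp_series A t y = (\<Sum>n. (t ^ n / fact n) *\<^sub>R (A ^^ n) y)"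

lemma exp_series_summable:
  fixes A :: "'a::euclidean_space \<Rightarrow> 'a"
  assumes "linear A"
  shows "summable (\<lambda>n. (t ^ n / fact n) *\<^sub>R (A ^^ n) y)"
proof -
  obtain K where K: "\<And>v. norm (A v) \<le> norm v * K" "K > 0"
    using assms linear_conv_bounded_linear bounded_linear.pos_bounded by blast
  have pow: "norm ((A ^^ n) y) \<le> K ^ n * norm y" for n
  proof (induction n)
    case (Suc n)
    have "norm ((A ^^ Suc n) y) \<le> norm ((A ^^ n) y) * K" using K by simp
    also have "\<dots> \<le> (K ^ n * norm y) * K" using Suc K by (intro mult_right_mono) auto
    finally show ?case by (simp add: ac_simps)
  qed simp
  have "summable (\<lambda>n. norm y * ((\<bar>t\<bar> * K) ^ n /\<^sub>R fact n))"
    by (intro summable_mult summable_exp_generic)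
  then show ?thesis
  proof (rule summable_comparison_test'[where N = 0])
    fix n
    have "norm ((t ^ n / fact n) *\<^sub>R (A ^^ n) y) \<le> \<bar>t\<bar> ^ n / fact n * (K ^ n * norm y)"
      using pow[of n] by (simp add: power_abs mult_left_mono divide_right_mono)
    then show "norm ((t ^ n / fact n) *\<^sub>R (A ^^ n) y) \<le> norm y * ((\<bar>t\<bar> * K) ^ n /\<^sub>R fact n)"
      by (simp add: power_mult_distrib field_simps)
  qed
qed

lemma exp_series_sums:
  assumes "linear A"
  shows "(\<lambda>n. (t ^ n / fact n) *\<^sub>R (A ^^ n) y) sums exp_series A t y"
  using exp_series_summable[OF assms] unfolding exp_series_def by (rule summable_sums)

text \<open>Linear maps are continuous in finite dimension and so pass through the series. This
  serves for coordinates, for \<open>ip u\<close>, for \<theta> and for \<open>A\<close>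
  itself.\<close>

lemma exp_series_image_sums:
  fixes f :: "'a::euclidean_space \<Rightarrow> 'b::real_normed_vector"
  assumes "linear A" and f: "linear f"
  shows "(\<lambda>n. (t ^ n / fact n) *\<^sub>R f ((A ^^ n) y)) sums f (exp_series A t y)"
  using bounded_linear.sums[OF _ exp_series_sums[OF assms(1)], of f t y] f
  by (simp add: linear_conv_bounded_linear linear_scale)

lemma exp_series_0 [simp]: "exp_series A 0 y = y"
proof -
  have "exp_series A 0 y = (\<Sum>n\<in>{0}. (0 ^ n / fact n) *\<^sub>R (A ^^ n) y)"
    unfolding exp_series_def by (rule suminf_finite) auto
  then show ?thesis by simp
qed

lemma exp_series_commute:
  assumes "linear A" shows "A (exp_series A t y) = exp_series A t (A y)"
proof -
  have "(\<lambda>n. (t ^ n / fact n) *\<^sub>R A ((A ^^ n) y)) sums A (exp_series A t y)"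
    by (rule exp_series_image_sums[OF assms assms])
  moreover have "A ((A ^^ n) y) = (A ^^ n) (A y)" for n
    by (rule funpow_swap1)
  ultimately show ?thesis
    using exp_series_sums[OF assms, of t "A y"] sums_unique2 by (metis (no_types, lifting) ext)
qed

lemma exp_series_has_vector_derivative:
  fixes A :: "'a::euclidean_space \<Rightarrow> 'a"
  assumes A: "linear A"
  shows "((\<lambda>t. exp_series A t y) has_vector_derivative A (exp_series A t y)) (at t)"
proof -
  have "((\<lambda>s. exp_series A s y \<bullet> b) has_field_derivative A (exp_series A t y) \<bullet> b) (at t)" for b
  proof -
    define c where "c n = ((A ^^ n) y \<bullet> b) / fact n" for n
    have lin: "linear (\<lambda>v. v \<bullet> b)"
      by (intro linearI) (auto simp: inner_add_left)
    have s: "(\<lambda>n. c n * s ^ n) sums (exp_series A s y \<bullet> b)" for s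
      using exp_series_image_sums[OF A lin, of s y] by (simp add: c_def mult.commute)
    \<comment> \<open>The factor \<open>n + 1\<close> produced by differentiation cancels against
      the factorial, leaving the series that starts from \<open>A y\<close>.\<close>
    have d: "diffs c n * t ^ n = (t ^ n / fact n) *\<^sub>R ((A ^^ n) (A y) \<bullet> b)" for n
      by (simp add: diffs_def c_def funpow_swap1 field_simps del: of_nat_Suc)
    have "((\<lambda>s. \<Sum>n. c n * s ^ n) has_field_derivative (\<Sum>n. diffs c n * t ^ n)) (at t)"
      using s by (intro termdiffs_strong_converges_everywhere) (blast dest: sums_summable)
    moreover have "(\<Sum>n. diffs c n * t ^ n) = A (exp_series A t y) \<bullet> b"
      using exp_series_image_sums[OF A lin, of t "A y"]
      by (simp only: d exp_series_commute[OF A] sums_unique[symmetric])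
    ultimately show ?thesis
      using sums_unique[OF s] by simp
  qed
  then show ?thesis
    unfolding has_real_derivative_iff_has_vector_derivative has_vector_derivative_def
    by (subst has_derivative_componentwise_within) simp
qed

section \<open>Bilinear forms and a second-order differential inequality\<close>

lemma bilinear_has_real_derivative:
  fixes ip :: "'a::euclidean_space \<Rightarrow> 'a \<Rightarrow> real"
  assumes "bilinear ip" "(u has_vector_derivative u') (at t)" "(v has_vector_derivative v') (at t)"
  shows "((\<lambda>t. ip (u t) (v t)) has_real_derivative ip (u t) v' + ip u' (v t)) (at t)"
  using bounded_bilinear.has_vector_derivative[OF _ assms(2,3), of ip] assms(1)
  by (simp add: bilinear_conv_bounded_bilinear has_real_derivative_iff_has_vector_derivative)

lemma bilinear_cauchy_schwarz:
  fixes ip :: "'a::real_vector \<Rightarrow> 'a \<Rightarrow> real"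
  assumes bil: "bilinear ip" and sym: "\<And>u v. ip u v = ip v u" and pos: "\<And>u. ip u u \<ge> 0"
  shows "(ip u v)\<^sup>2 \<le> ip u u * ip v v"
proof -
  have "ip v v * s\<^sup>2 + 2 * ip u v * s + ip u u \<ge> 0" for s
    using pos[of "u + s *\<^sub>R v"] sym[of v u]
    by (simp add: bilinear_ladd[OF bil] bilinear_radd[OF bil] bilinear_lmul[OF bil]
        bilinear_rmul[OF bil] power2_eq_square algebra_simps)
  note q = this
  show ?thesis
  proof (cases "ip v v = 0")
    case True
    have "ip u v = 0"
    proof (rule ccontr)
      assume "ip u v \<noteq> 0"
      \<comment> \<open>With \<open>ip v v = 0\<close> the expression is affine in \<open>s\<close>,
        and this \<open>s\<close> makes it equal to -1.\<close>
      then show False using q[of "- (ip u u + 1) / (2 * ip u v)"] True by simp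
    qed
    then show ?thesis using True by simp
  next
    case False
    then have "ip v v > 0" using pos[of v] by simp
    \<comment> \<open>This \<open>s\<close> minimises the quadratic.\<close>
    then show ?thesis using q[of "- ip u v / ip v v"]
      by (simp add: power2_eq_square field_simps)
  qed
qed

text \<open>The energy \<open>F1^2 - c F^2\<close> has derivative \<open>2 F1 (F2 - c F)\<close>. It
  is nonnegative for \<open>t \<ge> 0\<close>, because \<open>F1\<close> starts at 0 and is
  nondecreasing.\<close>

lemma energy_estimate_nonneg:
  fixes F F1 F2 :: "real \<Rightarrow> real"
  assumes F: "\<And>t. (F has_real_derivative F1 t) (at t)"
    and F1: "\<And>t. (F1 has_real_derivative F2 t) (at t)"
    and "F1 0 = 0" and c: "c \<ge> 0" and pos: "\<And>t. F t \<ge> 0" and F2: "\<And>t. F2 t \<ge> c * F t" and "t \<ge> 0"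
  shows "c * ((F t)\<^sup>2 - (F 0)\<^sup>2) \<le> (F1 t)\<^sup>2"
proof -
  have F1_pos: "F1 s \<ge> 0" if "s \<ge> 0" for s
  proof -
    have "F2 r \<ge> 0" for r
      by (rule order_trans[OF mult_nonneg_nonneg[OF c pos] F2])
    then have "F1 0 \<le> F1 s"
      using F1 by (intro DERIV_nonneg_imp_nondecreasing[OF that]) blast
    then show ?thesis by (simp add: \<open>F1 0 = 0\<close>)
  qed
  let ?E = "\<lambda>s. (F1 s)\<^sup>2 - c * (F s)\<^sup>2"
  have "?E 0 \<le> ?E t"
  proof (rule DERIV_nonneg_imp_nondecreasing[OF \<open>t \<ge> 0\<close>])
    fix s :: real assume "0 \<le> s"
    have "(?E has_real_derivative 2 * F1 s * (F2 s - c * F s)) (at s)"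
      by (auto intro!: derivative_eq_intros F F1 simp: algebra_simps)
    moreover have "2 * F1 s * (F2 s - c * F s) \<ge> 0"
      using F1_pos[OF \<open>0 \<le> s\<close>] F2[of s] by simp
    ultimately show "\<exists>e. (?E has_real_derivative e) (at s) \<and> e \<ge> 0" by blast
  qed
  then show ?thesis by (simp add: \<open>F1 0 = 0\<close> algebra_simps)
qed

text \<open>Negative times follow by reflecting \<open>t\<close>; this flips the sign of the first
  derivative, which enters only squared.\<close>

lemma energy_estimate:
  fixes F F1 F2 :: "real \<Rightarrow> real"
  assumes F: "\<And>t. (F has_real_derivative F1 t) (at t)"
    and F1: "\<And>t. (F1 has_real_derivative F2 t) (at t)"
    and "F1 0 = 0" and "c \<ge> 0" and "\<And>t. F t \<ge> 0" and "\<And>t. F2 t \<ge> c * F t"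
  shows "c * ((F t)\<^sup>2 - (F 0)\<^sup>2) \<le> (F1 t)\<^sup>2"
proof (cases "t \<ge> 0")
  case True
  then show ?thesis using energy_estimate_nonneg[of F F1 F2] assms by blast
next
  case False
  have "((\<lambda>t. F (- t)) has_real_derivative - F1 (- s)) (at s)" for s
    using F DERIV_mirror by blast
  moreover have "((\<lambda>t. - F1 (- t)) has_real_derivative F2 (- s)) (at s)" for s
    using DERIV_minus[OF DERIV_mirror[THEN iffD1, OF F1]] by simp
  ultimately show ?thesis
    using energy_estimate_nonneg[of "\<lambda>t. F (- t)" "\<lambda>t. - F1 (- t)" "\<lambda>t. F2 (- t)" c "- t"] assms False
    by simp
qed

section \<open>Self-adjoint operators and growth of their exponentials\<close>

lemma self_adjoint_funpow:
  assumes "\<And>u v. ip (A u) v = ip u (A v)"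
  shows "ip ((A ^^ n) u) v = ip u ((A ^^ n) v)"
  using assms by (induction n arbitrary: u v) (simp_all add: funpow_swap1)

text \<open>Moving exponential time \<open>r\<close> from one argument to the other leaves the
  pairing constant; the values at \<open>r = s\<close> and \<open>r = 0\<close> are
  compared.\<close>

lemma self_adjoint_exp_series:
  fixes ip :: "'a::euclidean_space \<Rightarrow> 'a \<Rightarrow> real"
  assumes bil: "bilinear ip" and A: "linear A" and adj: "\<And>u v. ip (A u) v = ip u (A v)"
  shows "ip (exp_series A s u) (exp_series A t v) = ip u (exp_series A (s + t) v)"
proof -
  have "((\<lambda>r. ip (exp_series A r u) (exp_series A (s + t - r) v)) has_real_derivative 0) (at r)" for r
  proof -
    have "((\<lambda>r. s + t - r) has_vector_derivative - 1) (at r)"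
      by (auto intro!: derivative_eq_intros)
    from vector_diff_chain_at[OF this exp_series_has_vector_derivative[OF A, of v]]
    have "((\<lambda>r. exp_series A (s + t - r) v) has_vector_derivative
        - A (exp_series A (s + t - r) v)) (at r)"
      by (simp add: o_def)
    from bilinear_has_real_derivative[OF bil exp_series_has_vector_derivative[OF A, of u] this]
    show ?thesis by (simp add: adj bilinear_rneg[OF bil])
  qed
  then have "ip (exp_series A s u) (exp_series A (s + t - s) v)
      = ip (exp_series A 0 u) (exp_series A (s + t - 0) v)"
    by (intro DERIV_isconst_all) blast
  then show ?thesis by simp
qed

text \<open>
  As \<open>A\<close> is self-adjoint, both sides are power series in \<open>2 t\<close> whose odd terms vanish; the
  coefficients are compared through the log-convexity of the moments \<open>ip ((A ^^ n) y) ((A ^^ n) y)\<close>.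
\<close>
lemma self_adjoint_exp_series_growth:
  fixes ip :: "'a::euclidean_space \<Rightarrow> 'a \<Rightarrow> real"
  assumes bil: "bilinear ip" and sym: "\<And>u v. ip u v = ip v u" and pos: "\<And>u. ip u u \<ge> 0"
    and A: "linear A" and adj: "\<And>u v. ip (A u) v = ip u (A v)"
    and odd: "\<And>n. odd n \<Longrightarrow> ip y ((A ^^ n) y) = 0"
  shows "ip (A y) (A y) * ip (exp_series A t y) (exp_series A t y)
    \<le> ip y y * ip (A (exp_series A t y)) (A (exp_series A t y))"
proof -
  define M where "M n = ip ((A ^^ n) y) ((A ^^ n) y)" for n
  have M_even: "ip y ((A ^^ n) y) = M (n div 2)" if "even n" for n
  proof -
    define k where "k = n div 2"
    have k: "n = k + k" using that by (auto simp: k_def elim!: evenE)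
    have "M k = ip y ((A ^^ k) ((A ^^ k) y))"
      unfolding M_def by (rule self_adjoint_funpow) (rule adj)
    moreover have "n div 2 = k" by (simp add: k_def)
    ultimately show ?thesis unfolding k by (simp add: funpow_add)
  qed
  have M_pos: "M n \<ge> 0" for n using pos by (simp add: M_def)
  have M_cs: "(M (Suc n))\<^sup>2 \<le> M n * M (Suc (Suc n))" for n
    using bilinear_cauchy_schwarz[OF bil sym pos, of "(A ^^ n) y" "(A ^^ Suc (Suc n)) y"]
    by (simp add: M_def adj)
  \<comment> \<open>Log-convexity says that the ratios \<open>M (n+1) / M n\<close> increase from
    \<open>M 1 / M 0\<close>. The product form also covers vanishing moments.\<close>
  have M_growth: "M 1 * M n \<le> M 0 * M (Suc n)" for n
  proof (induction n)
    case (Suc n)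
    show ?case
    proof (cases "M (Suc n) = 0")
      case True
      then show ?thesis using M_pos by simp
    next
      case False
      then have pos1: "M (Suc n) > 0" using M_pos[of "Suc n"] by simp
      then have "M n * M (Suc (Suc n)) > 0" using M_cs[of n] by (smt (verit) zero_less_power)
      then have posn: "M n > 0" using M_pos[of n] by (smt (verit) mult_eq_0_iff)
      have "M n * (M 1 * M (Suc n)) \<le> M 0 * (M (Suc n))\<^sup>2"
        using mult_right_mono[OF Suc, of "M (Suc n)"] pos1 by (simp add: power2_eq_square ac_simps)
      also have "\<dots> \<le> M n * (M 0 * M (Suc (Suc n)))"
        using mult_left_mono[OF M_cs M_pos[of 0], of n] by (simp add: ac_simps)
      finally show ?thesis using posn by simp
    qed
  qed (simp add: mult.commute)
  have lin: "linear (ip u)" for u using bil by (simp add: bilinear_def)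
  \<comment> \<open>Self-adjointness collects both exponentials into one at time
    \<open>2 * t\<close>, so each side becomes a single series.\<close>
  have "ip (A y) (A y) * ip y (exp_series A (2 * t) y) \<le> ip y y * ip (A y) (exp_series A (2 * t) (A y))"
  proof (rule sums_le)
    show "(\<lambda>n. ip (A y) (A y) * (((2 * t) ^ n / fact n) *\<^sub>R ip y ((A ^^ n) y)))
        sums (ip (A y) (A y) * ip y (exp_series A (2 * t) y))"
      by (intro sums_mult exp_series_image_sums A lin)
    show "(\<lambda>n. ip y y * (((2 * t) ^ n / fact n) *\<^sub>R ip (A y) ((A ^^ n) (A y))))
        sums (ip y y * ip (A y) (exp_series A (2 * t) (A y)))"
      by (intro sums_mult exp_series_image_sums A lin)
    fix n
    have shift: "ip (A y) ((A ^^ n) (A y)) = ip y ((A ^^ Suc (Suc n)) y)"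
      by (simp add: adj funpow_swap1)
    show "ip (A y) (A y) * (((2 * t) ^ n / fact n) *\<^sub>R ip y ((A ^^ n) y))
        \<le> ip y y * (((2 * t) ^ n / fact n) *\<^sub>R ip (A y) ((A ^^ n) (A y)))"
    proof (cases "even n")
      case True
      \<comment> \<open>For even \<open>n\<close> the weight is nonnegative whatever the sign of
        \<open>t\<close>.\<close>
      have "(2 * t) ^ n / fact n * (M 1 * M (n div 2)) \<le> (2 * t) ^ n / fact n * (M 0 * M (Suc (n div 2)))"
        using True by (intro mult_left_mono M_growth) (simp add: zero_le_even_power)
      moreover have "ip (A y) (A y) = M 1" "ip y y = M 0" by (simp_all add: M_def)
      ultimately show ?thesis
        using True by (simp add: shift M_even ac_simps del: funpow.simps)
    next
      case False
      then show ?thesis by (simp add: shift odd del: funpow.simps)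
    qed
  qed
  then show ?thesis
    by (simp add: self_adjoint_exp_series[where ip = ip and A = A, OF bil A adj] exp_series_commute[OF A]
        flip: mult_2)
qed


section \<open>The moment map along the flow\<close>

lemma sums_Pair:
  fixes f :: "nat \<Rightarrow> 'a::real_normed_vector" and g :: "nat \<Rightarrow> 'b::real_normed_vector"
  assumes "f sums a" "g sums b"
  shows "(\<lambda>n. (f n, g n)) sums (a, b)"
proof -
  have "(\<Sum>i<n. (f i, g i)) = (\<Sum>i<n. f i, \<Sum>i<n. g i)" for n
    by (induction n) (auto simp: zero_prod_def)
  then show ?thesis
    using assms by (auto simp: sums_def intro: tendsto_Pair)
qed

lemma exp_series_fixed:
  assumes "linear A" "A x = 0"
  shows "exp_series A t x = x"
proof -
  have "(A ^^ n) x = 0" if "n > 0" for n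
    using that assms by (cases n) (auto simp: funpow_swap1 linear_0[OF linear_funpow])
  then have "exp_series A t x = (\<Sum>n\<in>{0}. (t ^ n / fact n) *\<^sub>R (A ^^ n) x)"
    unfolding exp_series_def by (intro suminf_finite) auto
  then show ?thesis by simp
qed

text \<open>As \<open>t x\<close> is real, its \<open>ad\<close> acts separately on real and
  imaginary parts, and it kills \<open>x\<close>.\<close>

lemma flow_eq_exp_series:
  fixes br :: "'a::euclidean_space \<Rightarrow> 'a \<Rightarrow> 'a"
  assumes L: "lie_algebra br"
  shows "flow br t (x, y) = (x, exp_series (br x) t y)"
proof -
  have bil: "bilinear br" and alt: "br x x = 0"
    using L by (auto simp: lie_algebra_def)
  note A = linear_ad[OF bil, of x]
  have pow: "(cbr br (t *\<^sub>R x, 0) ^^ n) (u, v) = (t ^ n *\<^sub>R (br x ^^ n) u, t ^ n *\<^sub>R (br x ^^ n) v)" for n u v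
    by (induction n)
      (auto simp: cbr_def bilinear_lzero[OF bil] bilinear_lmul[OF bil] bilinear_rmul[OF bil])
  have "(\<lambda>n. (cbr br (t *\<^sub>R x, 0) ^^ n) (x, y) /\<^sub>R fact n)
      sums (exp_series (br x) t x, exp_series (br x) t y)"
    using sums_Pair[OF exp_series_sums[OF A] exp_series_sums[OF A]]
    by (simp add: pow divide_inverse mult.commute)
  then show ?thesis
    by (simp add: flow_def Ad_def lie_exp_def re_part_def cnjg_def sums_iff
        exp_series_fixed[OF A alt] flip: scaleR_2)
qed

section \<open>The inner product on the real form and its Cartan decomposition\<close>

locale cartan_decomposition =
  fixes br :: "'a::euclidean_space \<Rightarrow> 'a \<Rightarrow> 'a" and \<theta> :: "'a \<Rightarrow> 'a"
    and B :: "'a \<Rightarrow> 'a \<Rightarrow> real" and c :: real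
  assumes lie: "lie_algebra br" and cartan: "cartan_involution br \<theta>"
    and c: "c > 0" and B: "B x y = c * killing_form br x y"
begin

text \<open>The hermitian inner product restricted to the real form, as \<open>herm_of_real\<close>
  confirms.\<close>

definition ip :: "'a \<Rightarrow> 'a \<Rightarrow> real" where
  "ip u v = - B u (\<theta> v)"

lemma bil: "bilinear br"
  using lie by (simp add: lie_algebra_def)

lemma bracket_self [simp]: "br x x = 0"
  using lie by (simp add: lie_algebra_def)

lemma \<theta>_linear: "linear \<theta>" and \<theta>_\<theta> [simp]: "\<theta> (\<theta> x) = x"
  and \<theta>_br: "\<theta> (br x y) = br (\<theta> x) (\<theta> y)"
  using cartan by (auto simp: cartan_involution_def)

lemma \<theta>_neg: "\<theta> (- x) = - \<theta> x"
  using linear_neg[OF \<theta>_linear] .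

lemma bilinear_B: "bilinear B"
proof -
  note K = killing_form_bilinear[OF bil]
  show ?thesis
    unfolding bilinear_def B
    by (auto intro!: linearI simp: bilinear_ladd[OF K] bilinear_radd[OF K]
        bilinear_lmul[OF K] bilinear_rmul[OF K] algebra_simps)
qed

lemma B_invariant: "B (br x y) z = B x (br y z)"
  by (simp add: B killing_form_invariant[OF lie])

lemma bilinear_ip: "bilinear ip"
  unfolding bilinear_def ip_def
  by (auto intro!: linearI simp: linear_add[OF \<theta>_linear] linear_scale[OF \<theta>_linear]
      bilinear_ladd[OF bilinear_B] bilinear_radd[OF bilinear_B]
      bilinear_lmul[OF bilinear_B] bilinear_rmul[OF bilinear_B])

lemma B_\<theta>: "B (\<theta> u) (\<theta> v) = B u v"
  unfolding B using killing_form_automorphism[where \<theta> = \<theta>] bil \<theta>_linear \<theta>_\<theta> \<theta>_br by metis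

lemma B_commute: "B u v = B v u"
  unfolding B by (simp only: killing_form_commute[OF bil, of u])

lemma ip_\<theta>: "ip (\<theta> u) (\<theta> v) = ip u v"
  unfolding ip_def B_\<theta> ..

lemma ip_commute: "ip u v = ip v u"
  using B_\<theta>[of u "\<theta> v"] B_commute[of "\<theta> u" v] by (simp add: ip_def)

lemma ip_pos: "u \<noteq> 0 \<Longrightarrow> ip u u > 0"
  using cartan c by (simp add: cartan_involution_def ip_def B mult_pos_neg)

lemma ip_nonneg: "ip u u \<ge> 0"
  using ip_pos[of u] bilinear_lzero[OF bilinear_ip] by (cases "u = 0") auto

lemma ip_scaleR: "ip (a *\<^sub>R u) (a *\<^sub>R u) = a\<^sup>2 * ip u u"
  by (simp add: bilinear_lmul[OF bilinear_ip] bilinear_rmul[OF bilinear_ip] power2_eq_square)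

lemma hnorm_power2: "(hnorm B \<theta> (u, v))\<^sup>2 = ip u u + ip v v"
proof -
  have "Re (herm B \<theta> (u, v) (u, v)) = ip u u + ip v v"
    by (simp add: herm_def cform_def cinv_def cnjg_def ip_def \<theta>_neg bilinear_rneg[OF bilinear_B])
  then show ?thesis
    using ip_nonneg[of u] ip_nonneg[of v] by (simp add: hnorm_def)
qed

lemma herm_of_real: "herm B \<theta> (u, 0) (v, 0) = of_real (ip u v)"
  by (simp add: herm_def cform_def cinv_def cnjg_def ip_def linear_0[OF \<theta>_linear]
      bilinear_lzero[OF bilinear_B] bilinear_rzero[OF bilinear_B] complex_eq_iff)

lemma \<theta>_ad:
  assumes "\<theta> x = - x"
  shows "\<theta> (br x u) = - br x (\<theta> u)"
  by (simp add: \<theta>_br assms bilinear_lneg[OF bil])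

text \<open>For \<open>x\<close> in \<open>pR \<theta>\<close>, \<open>ad x\<close> is skew for
  \<open>B\<close> and anticommutes with \<theta>; the two signs cancel.\<close>

lemma ad_self_adjoint:
  assumes "\<theta> x = - x"
  shows "ip (br x u) v = ip u (br x v)"
proof -
  have "B (br x u) (\<theta> v) = - B (br u x) (\<theta> v)"
    by (subst lie_algebra_skew[OF lie]) (simp add: bilinear_lneg[OF bilinear_B])
  also have "\<dots> = - B u (br x (\<theta> v))" by (simp add: B_invariant)
  also have "\<dots> = B u (\<theta> (br x v))" by (simp add: \<theta>_ad[OF assms] bilinear_rneg[OF bilinear_B])
  finally show ?thesis by (simp add: ip_def)
qed

text \<open>This supplies the coefficient of the moment map along \<open>x\<close>, by invariance of
  \<open>B\<close>.\<close>

lemma ip_bracket_\<theta>: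
  assumes "\<theta> x = - x"
  shows "ip (br u (\<theta> u)) x = - ip u (br x u)"
proof -
  have "B (br u (\<theta> u)) (\<theta> x) = - B u (br (\<theta> u) x)"
    by (simp add: assms bilinear_rneg[OF bilinear_B] B_invariant)
  also have "\<dots> = B u (br x (\<theta> u))"
    by (subst lie_algebra_skew[OF lie]) (simp add: bilinear_rneg[OF bilinear_B])
  also have "\<dots> = - B u (\<theta> (br x u))"
    by (simp add: \<theta>_ad[OF assms] bilinear_rneg[OF bilinear_B])
  finally show ?thesis by (simp add: ip_def)
qed

text \<open>Only \<open>x\<close> is taken in \<open>pR \<theta>\<close>: the flow fixes the real
  part but in general moves the imaginary part \<open>u\<close> out of
  \<open>pR \<theta>\<close>.\<close>

lemma moment_map_eq:
  assumes "\<theta> x = - x"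
  shows "moment_map br B \<theta> (x, u) =
    inverse (ip x x + ip u u) *\<^sub>R (- br u (\<theta> u), br x (\<theta> u) - br x u)"
proof -
  have "cbr br (x, u) (cinv \<theta> (cnjg (x, u))) = - (- br u (\<theta> u), br x (\<theta> u) - br x u)"
    using lie_algebra_skew[OF lie, of u x]
    by (simp add: cbr_def cinv_def cnjg_def assms \<theta>_neg bilinear_rneg[OF bil])
  then show ?thesis
    by (simp add: moment_map_def hnorm_power2 scaleR_right_diff_distrib)
qed

lemma \<theta>_ad_funpow:
  assumes "\<theta> x = - x" "\<theta> y = - y"
  shows "\<theta> ((br x ^^ n) y) = - ((- 1) ^ n *\<^sub>R (br x ^^ n) y)"
  by (induction n) (simp_all add: assms \<theta>_ad bilinear_rneg[OF bil] bilinear_rmul[OF bil])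

text \<open>Odd powers of \<open>ad x\<close> carry \<open>y\<close> into
  \<open>kR \<theta>\<close>, which is orthogonal to \<open>pR \<theta>\<close>.\<close>

lemma ip_ad_funpow_odd:
  assumes "\<theta> x = - x" "\<theta> y = - y" "odd n"
  shows "ip y ((br x ^^ n) y) = 0"
proof -
  have "ip y ((br x ^^ n) y) = ip (\<theta> y) (\<theta> ((br x ^^ n) y))"
    by (simp add: ip_\<theta>)
  also have "\<dots> = - ip y ((br x ^^ n) y)"
    using assms by (simp add: \<theta>_ad_funpow bilinear_lneg[OF bilinear_ip] bilinear_rneg[OF bilinear_ip])
  finally show ?thesis by simp
qed

lemma \<theta>_exp_series:
  assumes "\<theta> x = - x" "\<theta> y = - y"
  shows "\<theta> (exp_series (br x) t y) = - exp_series (br x) (- t) y"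
proof -
  note A = linear_ad[OF bil, of x]
  have "(\<lambda>n. (t ^ n / fact n) *\<^sub>R \<theta> ((br x ^^ n) y)) sums \<theta> (exp_series (br x) t y)"
    by (rule exp_series_image_sums[OF A \<theta>_linear])
  moreover have "(t ^ n / fact n) *\<^sub>R \<theta> ((br x ^^ n) y) = - (((- t) ^ n / fact n) *\<^sub>R (br x ^^ n) y)" for n
    by (simp add: \<theta>_ad_funpow[OF assms] power_minus[of t])
  ultimately show ?thesis
    using sums_minus[OF exp_series_sums[OF A, of "- t" y]] by (simp add: sums_unique2)
qed

text \<open>The left summands are the squared norms of \<open>m1\<close> and \<open>m3\<close> at
  time \<open>t\<close>; the right side is that of the moment map at time 0.\<close>

lemma moment_norm_inequality:
  fixes x y Y :: 'a and t :: real
  assumes x: "\<theta> x = - x" and y: "\<theta> y = - y" and xy: "ip x x = ip y y" and x0: "x \<noteq> 0"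
  defines "Y \<equiv> exp_series (br x) t y"
  shows "(ip Y (br x Y))\<^sup>2 / (ip x x * (ip x x + ip Y Y)\<^sup>2)
      + ip (br x (\<theta> Y) - br x Y) (br x (\<theta> Y) - br x Y) / (ip x x + ip Y Y)\<^sup>2
    \<ge> ip (br x y) (br x y) / (ip x x)\<^sup>2"
proof -
  note A = linear_ad[OF bil, of x]
  note adj = ad_self_adjoint[OF x]
  note ipl = bilinear_lneg[OF bilinear_ip] bilinear_rneg[OF bilinear_ip]
    bilinear_ladd[OF bilinear_ip] bilinear_radd[OF bilinear_ip]
  define E where "E s = exp_series (br x) s y" for s
  define r where "r = ip x x"
  define S where "S = ip (br x y) (br x y)"
  define F where "F s = ip (E s) (E s)" for s
  \<comment> \<open>\<open>F1\<close> and \<open>F2\<close> are the first two derivatives of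
    \<open>F\<close>, simplified by self-adjointness of \<open>ad x\<close>.\<close>
  define F1 where "F1 s = 2 * ip (E s) (br x (E s))" for s
  define F2 where "F2 s = 4 * ip (br x (E s)) (br x (E s))" for s
  have rpos: "r > 0" using ip_pos[OF x0] by (simp add: r_def)
  have S: "S \<ge> 0" by (simp add: S_def ip_nonneg)
  have E0: "E 0 = y" by (simp add: E_def)
  have dE: "(E has_vector_derivative br x (E s)) (at s)" for s
    unfolding E_def by (rule exp_series_has_vector_derivative[OF A])
  have dAE: "((\<lambda>s. br x (E s)) has_vector_derivative br x (br x (E s))) (at s)" for s
    using exp_series_has_vector_derivative[OF A, of "br x y" s]
    by (simp add: E_def exp_series_commute[OF A])
  have dF: "(F has_real_derivative F1 s) (at s)" for s
    using bilinear_has_real_derivative[OF bilinear_ip dE dE, of s]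
    by (simp add: F_def[abs_def] F1_def ip_commute[of "br x (E s)"])
  have dF1: "(F1 has_real_derivative F2 s) (at s)" for s
    using DERIV_cmult[OF bilinear_has_real_derivative[OF bilinear_ip dE dAE, of s], of 2]
    by (simp add: F1_def[abs_def] F2_def adj)
  have growth: "S * F s \<le> r * (F2 s / 4)" for s
    using self_adjoint_exp_series_growth[where ip = ip and A = "br x", OF bilinear_ip ip_commute ip_nonneg A adj
        ip_ad_funpow_odd[OF x y], of s]
    by (simp add: S_def F_def F2_def E_def r_def xy)
  have F10: "F1 0 = 0"
    using ip_ad_funpow_odd[OF x y, of 1] by (simp add: F1_def E0)
  have "4 * S / r * ((F t)\<^sup>2 - (F 0)\<^sup>2) \<le> (F1 t)\<^sup>2"
  proof (rule energy_estimate[OF dF dF1 F10])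
    show "4 * S / r * F s \<le> F2 s" for s
      using growth[of s] rpos by (simp add: field_simps)
  qed (use S rpos in \<open>simp_all add: F_def ip_nonneg\<close>)
  moreover have "F 0 = r" by (simp add: F_def E0 r_def xy)
  ultimately have energy: "S * ((F t)\<^sup>2 - r\<^sup>2) \<le> r * (F1 t / 2)\<^sup>2"
    using rpos by (simp add: field_simps)
  \<comment> \<open>The exponentials at times \<open>t\<close> and \<open>- t\<close> cancel once
    moved into the same argument.\<close>
  have "ip (br x (E t)) (br x (E (- t))) = S"
    using self_adjoint_exp_series[where ip = ip and A = "br x", OF bilinear_ip A adj, of t "br x y" "- t" "br x y"]
    by (simp add: E_def exp_series_commute[OF A] S_def)
  moreover have \<theta>E: "\<theta> (E t) = - E (- t)"
    unfolding E_def by (rule \<theta>_exp_series[OF x y])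
  moreover have "ip (br x (E (- t))) (br x (E (- t))) = ip (br x (E t)) (br x (E t))"
    using ip_\<theta>[of "br x (E t)" "br x (E t)"] by (simp add: \<theta>_ad[OF x] \<theta>E ipl bilinear_rneg[OF bil])
  \<comment> \<open>Up to sign the vector is \<open>A (E t) + A (E (- t))\<close>: two equal squared
    norms and twice the cross term \<open>S\<close>.\<close>
  ultimately have k: "ip (br x (\<theta> (E t)) - br x (E t)) (br x (\<theta> (E t)) - br x (E t)) = F2 t / 2 + 2 * S"
    using ip_commute[of "br x (E t)" "br x (E (- t))"]
    by (simp add: bilinear_rneg[OF bil] ipl bilinear_lsub[OF bilinear_ip] bilinear_rsub[OF bilinear_ip] F2_def)
  have Npos: "r + F t > 0" using rpos ip_nonneg[of "E t"] by (simp add: F_def)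
  \<comment> \<open>The split matches the available bounds: \<open>energy\<close> for the first
    term, \<open>growth\<close> for the second, and equality for the third.\<close>
  have "S * (r + F t)\<^sup>2 = S * ((F t)\<^sup>2 - r\<^sup>2) + 2 * r * (S * F t) + 2 * r\<^sup>2 * S"
    by (simp add: power2_eq_square algebra_simps)
  also have "\<dots> \<le> r * (F1 t / 2)\<^sup>2 + 2 * r * (r * (F2 t / 4)) + 2 * r\<^sup>2 * S"
    using rpos by (intro add_mono energy mult_left_mono growth) simp_all
  also have "\<dots> = r * (F1 t / 2)\<^sup>2 + r\<^sup>2 * (F2 t / 2 + 2 * S)"
    by (simp add: power2_eq_square algebra_simps)
  finally have "S * (r + F t)\<^sup>2 \<le> r * (F1 t / 2)\<^sup>2 + r\<^sup>2 * (F2 t / 2 + 2 * S)" .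
  then have "S / r\<^sup>2 \<le> (r * (F1 t / 2)\<^sup>2 + r\<^sup>2 * (F2 t / 2 + 2 * S)) / (r\<^sup>2 * (r + F t)\<^sup>2)"
    using rpos Npos by (simp add: divide_le_eq le_divide_eq field_simps)
  also have "\<dots> = (F1 t / 2)\<^sup>2 / (r * (r + F t)\<^sup>2) + (F2 t / 2 + 2 * S) / (r + F t)\<^sup>2"
    using rpos Npos by (simp add: add_divide_distrib power2_eq_square)
  finally show ?thesis
    using k by (simp add: Y_def E_def r_def S_def F_def F1_def)
qed

end

section \<open>Computation of the components and conclusion\<close>

theorem lemma8p5:
  fixes br :: "'a::euclidean_space \<Rightarrow> 'a \<Rightarrow> 'a"
    and \<theta> :: "'a \<Rightarrow> 'a"
    and B :: "'a \<Rightarrow> 'a \<Rightarrow> real"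
    and Orb :: "'a cplxn set"
    and \<zeta> :: "'a cplxn"
    and m m1 m2 m3 :: "real \<Rightarrow> 'a cplxn"
  assumes "semisimple br"
    and "cartan_involution br \<theta>"
    and "\<exists>c>0. \<forall>x y. B x y = c * killing_form br x y"
    and "\<exists>\<zeta>0. Orb = K_orbit br \<theta> \<zeta>0"
    and "\<forall>\<xi>\<in>Orb. \<xi> \<in> pC \<theta> \<and> \<xi> \<noteq> 0 \<and> ad_nilpotent br \<xi>"
    and "\<zeta> \<in> Orb"
    and "\<forall>t. m t = moment_map br B \<theta> (flow br t \<zeta>)"
    and "\<forall>t. m t = m1 t + m2 t + m3 t"
    and "\<forall>t. m1 t \<in> range (\<lambda>s. s *\<^sub>R re_part \<zeta>)"
    and "\<forall>t. m2 t \<in> of_real_form ` pR \<theta> \<and> herm B \<theta> (m2 t) (re_part \<zeta>) = 0"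
    and "\<forall>t. m3 t \<in> cscale \<i> ` of_real_form ` kR \<theta>"
  shows "\<forall>t. (hnorm B \<theta> (m1 t))\<^sup>2 + (hnorm B \<theta> (m3 t))\<^sup>2 \<ge> (hnorm B \<theta> (m 0))\<^sup>2"
proof
  fix t
  obtain c where c: "c > 0" "\<And>x y. B x y = c * killing_form br x y"
    using assms(3) by blast
  interpret cartan_decomposition br \<theta> B c
    using assms(1,2) c by unfold_locales (auto simp: semisimple_def)
  obtain x y where \<zeta>: "\<zeta> = (x, y)" by (cases \<zeta>)
  have x: "\<theta> x = - x" and y: "\<theta> y = - y" and nz: "(x, y) \<noteq> 0" and nil: "ad_nilpotent br (x, y)"
    using assms(5,6) by (auto simp: \<zeta> pC_def pR_def)
  have r: "ip x x = ip y y"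
    using killing_form_eq_of_ad_nilpotent[OF bil nil]
    by (simp add: ip_def x y bilinear_rneg[OF bilinear_B]) (simp add: B)
  \<comment> \<open>If \<open>x\<close> vanished, equality of the norms would force
    \<open>y = 0\<close> as well.\<close>
  have x0: "x \<noteq> 0"
    using r ip_pos[of y] nz bilinear_lzero[OF bilinear_ip] by (auto simp: zero_prod_def)
  have re: "re_part \<zeta> = (x, 0)"
    by (simp add: \<zeta> re_part_def cnjg_def flip: scaleR_2)
  define Y where "Y = exp_series (br x) t y"
  define N where "N = ip x x + ip Y Y"
  have m: "m t = inverse N *\<^sub>R (- br Y (\<theta> Y), br x (\<theta> Y) - br x Y)"
    using assms(7) by (simp add: \<zeta> flow_eq_exp_series[OF lie] moment_map_eq[OF x] Y_def N_def)
  \<comment> \<open>At time 0 the real component \<open>[y, \<theta> y]\<close> vanishes, and the 2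
    here cancels the 2 in \<open>N = 2 * ip x x\<close>.\<close>
  have "- br x y - br x y = - 2 *\<^sub>R br x y"
    by (simp add: scaleR_2)
  then have "m 0 = (0, (inverse (ip x x + ip x x) * - 2) *\<^sub>R br x y)"
    using assms(7)
    by (simp add: \<zeta> flow_eq_exp_series[OF lie] moment_map_eq[OF x] r[symmetric] y bilinear_rneg[OF bil])
  also have "inverse (ip x x + ip x x) * - 2 = - inverse (ip x x)"
    by simp
  finally have m0: "(hnorm B \<theta> (m 0))\<^sup>2 = ip (br x y) (br x y) / (ip x x)\<^sup>2"
    by (simp only: hnorm_power2 ip_scaleR) (simp add: bilinear_lzero[OF bilinear_ip] field_simps)
  obtain s where m1: "m1 t = (s *\<^sub>R x, 0)" using assms(9) re by (auto simp: image_iff)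
  obtain p where m2: "m2 t = (p, 0)" and p: "ip p x = 0"
    using assms(10) re herm_of_real by (force simp: of_real_form_def)
  obtain k where m3: "m3 t = (0, k)"
    using assms(11) by (force simp: of_real_form_def cscale_def)
  \<comment> \<open>Real and imaginary parts of the decomposition separate \<open>m1 + m2\<close>
    from \<open>m3\<close>.\<close>
  have sp: "s *\<^sub>R x + p = - (inverse N *\<^sub>R br Y (\<theta> Y))" and k: "k = inverse N *\<^sub>R (br x (\<theta> Y) - br x Y)"
    using assms(8)[rule_format, of t] by (simp_all add: m m1 m2 m3)
  \<comment> \<open>Pairing with \<open>x\<close> removes the orthogonal summand \<open>p\<close>
    and isolates \<open>s\<close>.\<close>
  have "s * ip x x = ip (s *\<^sub>R x + p) x"
    by (simp add: p bilinear_ladd[OF bilinear_ip] bilinear_lmul[OF bilinear_ip])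
  also have "\<dots> = inverse N * ip Y (br x Y)"
    by (simp add: sp bilinear_lneg[OF bilinear_ip] bilinear_lmul[OF bilinear_ip] ip_bracket_\<theta>[OF x])
  finally have s: "s = ip Y (br x Y) / (N * ip x x)"
    using ip_pos[OF x0] by (simp add: nonzero_eq_divide_eq[symmetric] divide_inverse)
  have "(hnorm B \<theta> (m1 t))\<^sup>2 = s\<^sup>2 * ip x x"
    unfolding m1 hnorm_power2 ip_scaleR by (simp add: bilinear_lzero[OF bilinear_ip])
  also have "\<dots> = (ip Y (br x Y))\<^sup>2 / (ip x x * N\<^sup>2)"
    using ip_pos[OF x0] by (simp add: s power2_eq_square)
  finally have m1_norm: "(hnorm B \<theta> (m1 t))\<^sup>2 = (ip Y (br x Y))\<^sup>2 / (ip x x * N\<^sup>2)" .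
  have m3_norm: "(hnorm B \<theta> (m3 t))\<^sup>2 = ip (br x (\<theta> Y) - br x Y) (br x (\<theta> Y) - br x Y) / N\<^sup>2"
    unfolding m3 hnorm_power2 k ip_scaleR
    by (simp add: bilinear_lzero[OF bilinear_ip] divide_inverse power_inverse mult.commute)
  show "(hnorm B \<theta> (m1 t))\<^sup>2 + (hnorm B \<theta> (m3 t))\<^sup>2 \<ge> (hnorm B \<theta> (m 0))\<^sup>2"
    unfolding m0 m1_norm m3_norm N_def Y_def by (rule moment_norm_inequality[OF x y r x0])
qed

end
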